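(* Let $G$ be a topological group and let $p\colon E\to B$ be a $G$-fibration. If $H$ and $K$ are subgroups of $G$ such that $E^H$ and $B^H$ are $K$-invariant, and the fixed point map $p^H\colon E^H\to B^H$ (the restriction of $p$) is a $K$-fibration, then $$\mathrm{TC}_K[p^H\colon E^H\to B^H]\le\mathrm{TC}_G[p\colon E\to B].$$
   Context: All spaces are Hausdorff, $I=[0,1]$, path spaces carry the compact-open topology. A $G$-map is a continuous equivariant map; a $G$-homotopy is an equivariant homotopy ($G$ acting trivially on $I$). A $G$-fibration is a $G$-map with the $G$-homotopy lifting property with respect to every $G$-space. For a $G$-space $X$ and a subgroup $H\le G$, $X^H=\{x\in X: h\cdot x=x\text{ for all }h\in H\}$. Equivariant sectional category: for a $G$-map $q\colon X\to Y$, $\mathrm{secat}_G(q)$ is the least positive integer $k$ such that $Y$ has a cover by $G$-invariant open sets $U_1,\dots,U_k$ with $G$-maps $s_i\colon U_i\to X$ such that $q\circ s_i$ is $G$-homotopic to the inclusion $U_i\hookrightarrow Y$ ($\infty$ if there is no such $k$). Equivariant parametrized topological complexity: for a $G$-fibration $p\colon E\to B$, let $E^I_B$ be the space of paths $\gamma\colon I\to E$ whose image lies in a single fibre of $p$, with $(g\cdot\gamma)(t)=g\cdot\gamma(t)$, and $E\times_B E=\{(e_1,e_2)\in E\times E: p(e_1)=p(e_2)\}$ with the diagonal action. The map $\Pi\colon E^I_B\to E\times_B E$, $\Pi(\gamma)=(\gamma(0),\gamma(1))$, is a $G$-fibration, and $\mathrm{TC}_G[p\colon E\to B]:=\mathrm{secat}_G(\Pi)$.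 *)

theory Defs
  imports "HOL-Analysis.Analysis" "HOL-Algebra.Group_Action" "HOL-Library.Extended_Nat"
begin

text \<open>
  All spaces are Hausdorff. The group, the spaces and the actions are given on carriers, so that
  subgroups, fixed point sets and invariant open sets are spaces in the same sense. Values of maps
  and actions outside the carriers are irrelevant.
\<close>

definition topological_group :: "('g, 'm) monoid_scheme \<Rightarrow> 'g topology \<Rightarrow> bool" where
  "topological_group G T \<longleftrightarrow>
     group G \<and> topspace T = carrier G \<and> Hausdorff_space T \<and>
     continuous_map (prod_topology T T) T (\<lambda>(g, h). g \<otimes>\<^bsub>G\<^esub> h) \<and>
     continuous_map T T (\<lambda>g. inv\<^bsub>G\<^esub> g)"

definition g_space ::
  "('g, 'm) monoid_scheme \<Rightarrow> 'g topology \<Rightarrow> 'x topology \<Rightarrow> ('g \<Rightarrow> 'x \<Rightarrow> 'x) \<Rightarrow> bool" where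
  "g_space G T X \<alpha> \<longleftrightarrow>
     Hausdorff_space X \<and>
     group_action G (topspace X) (\<lambda>g. restrict (\<alpha> g) (topspace X)) \<and>
     continuous_map (prod_topology T X) X (\<lambda>(g, x). \<alpha> g x)"

definition equivariant_on ::
  "('g, 'm) monoid_scheme \<Rightarrow> 'x set \<Rightarrow> ('g \<Rightarrow> 'x \<Rightarrow> 'x) \<Rightarrow> ('g \<Rightarrow> 'y \<Rightarrow> 'y) \<Rightarrow> ('x \<Rightarrow> 'y) \<Rightarrow> bool" where
  "equivariant_on G S \<alpha> \<beta> f \<longleftrightarrow> (\<forall>g\<in>carrier G. \<forall>x\<in>S. f (\<alpha> g x) = \<beta> g (f x))"

definition g_map ::
  "('g, 'm) monoid_scheme \<Rightarrow> 'x topology \<Rightarrow> ('g \<Rightarrow> 'x \<Rightarrow> 'x) \<Rightarrow> 'y topology \<Rightarrow> ('g \<Rightarrow> 'y \<Rightarrow> 'y) \<Rightarrow>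
    ('x \<Rightarrow> 'y) \<Rightarrow> bool" where
  "g_map G X \<alpha> Y \<beta> f \<longleftrightarrow> continuous_map X Y f \<and> equivariant_on G (topspace X) \<alpha> \<beta> f"

definition invariant_under :: "'g set \<Rightarrow> ('g \<Rightarrow> 'x \<Rightarrow> 'x) \<Rightarrow> 'x set \<Rightarrow> bool" where
  "invariant_under A \<alpha> S \<longleftrightarrow> (\<forall>g\<in>A. \<forall>x\<in>S. \<alpha> g x \<in> S)"

definition fixed_space :: "'x topology \<Rightarrow> ('g \<Rightarrow> 'x \<Rightarrow> 'x) \<Rightarrow> 'g set \<Rightarrow> 'x topology" where
  "fixed_space X \<alpha> H = subtopology X {x \<in> topspace X. \<forall>h\<in>H. \<alpha> h x = x}"

abbreviation subgroup_of :: "('g, 'm) monoid_scheme \<Rightarrow> 'g set \<Rightarrow> ('g, 'm) monoid_scheme" where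
  "subgroup_of G K \<equiv> G\<lparr>carrier := K\<rparr>"

abbreviation unit_interval :: "real topology" where
  "unit_interval \<equiv> top_of_set {0..1}"

text \<open>
  A homotopy is equivariant for the trivial action on the interval iff all its stages are
  equivariant. The library's \<open>homotopic_with\<close> fixes the two ends of the homotopy also outside
  \<open>topspace X\<close>; a homotopy can be redefined there without affecting continuity or, \<open>topspace X\<close>
  being invariant, equivariance.
\<close>

definition g_homotopic ::
  "('g, 'm) monoid_scheme \<Rightarrow> 'x topology \<Rightarrow> ('g \<Rightarrow> 'x \<Rightarrow> 'x) \<Rightarrow> 'y topology \<Rightarrow> ('g \<Rightarrow> 'y \<Rightarrow> 'y) \<Rightarrow>
    ('x \<Rightarrow> 'y) \<Rightarrow> ('x \<Rightarrow> 'y) \<Rightarrow> bool" where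
  "g_homotopic G X \<alpha> Y \<beta> = homotopic_with (equivariant_on G (topspace X) \<alpha> \<beta>) X Y"

abbreviation cylinder :: "'x topology \<Rightarrow> (real \<times> 'x) topology" where
  "cylinder X \<equiv> prod_topology unit_interval X"

abbreviation cylinder_action :: "('g \<Rightarrow> 'x \<Rightarrow> 'x) \<Rightarrow> 'g \<Rightarrow> real \<times> 'x \<Rightarrow> real \<times> 'x" where
  "cylinder_action \<alpha> \<equiv> \<lambda>g (t, x). (t, \<alpha> g x)"

definition g_homotopy_lifting ::
  "('g, 'm) monoid_scheme \<Rightarrow> 'x topology \<Rightarrow> ('g \<Rightarrow> 'x \<Rightarrow> 'x) \<Rightarrow>
    'e topology \<Rightarrow> ('g \<Rightarrow> 'e \<Rightarrow> 'e) \<Rightarrow> 'b topology \<Rightarrow> ('g \<Rightarrow> 'b \<Rightarrow> 'b) \<Rightarrow> ('e \<Rightarrow> 'b) \<Rightarrow> bool" where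
  "g_homotopy_lifting G X \<xi> E \<alpha> B \<beta> p \<longleftrightarrow>
     (\<forall>f h. g_map G X \<xi> E \<alpha> f \<and> g_map G (cylinder X) (cylinder_action \<xi>) B \<beta> h \<and>
        (\<forall>x\<in>topspace X. h (0, x) = p (f x)) \<longrightarrow>
        (\<exists>k. g_map G (cylinder X) (cylinder_action \<xi>) E \<alpha> k \<and>
           (\<forall>x\<in>topspace X. k (0, x) = f x) \<and>
           (\<forall>t\<in>{0..1}. \<forall>x\<in>topspace X. p (k (t, x)) = h (t, x))))"

text \<open>
  A definition cannot quantify over all types, so the test spaces range over all \<open>G\<close>-spaces carried
  by one type. That type is large enough to contain the mapping path space of \<open>p\<close>; hence lifting for
  its \<open>G\<close>-spaces gives lifting for the \<open>G\<close>-spaces on every type, see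
  \<open>g_fibration_homotopy_lifting\<close> at the end of this theory.
\<close>

definition g_fibration ::
  "('g, 'm) monoid_scheme \<Rightarrow> 'g topology \<Rightarrow>
    'e topology \<Rightarrow> ('g \<Rightarrow> 'e \<Rightarrow> 'e) \<Rightarrow> 'b topology \<Rightarrow> ('g \<Rightarrow> 'b \<Rightarrow> 'b) \<Rightarrow> ('e \<Rightarrow> 'b) \<Rightarrow> bool" where
  "g_fibration G T E \<alpha> B \<beta> p \<longleftrightarrow>
     g_space G T E \<alpha> \<and> g_space G T B \<beta> \<and> g_map G E \<alpha> B \<beta> p \<and>
     (\<forall>(X :: ('e \<times> (real \<Rightarrow> 'b)) topology) \<xi>.
        g_space G T X \<xi> \<longrightarrow> g_homotopy_lifting G X \<xi> E \<alpha> B \<beta> p)"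

text \<open>For a map \<open>q\<close> from \<open>X\<close> to \<open>Y\<close>; the infimum of the empty set is \<open>\<infinity>\<close>.\<close>

definition g_secat ::
  "('g, 'm) monoid_scheme \<Rightarrow> 'x topology \<Rightarrow> ('g \<Rightarrow> 'x \<Rightarrow> 'x) \<Rightarrow> 'y topology \<Rightarrow> ('g \<Rightarrow> 'y \<Rightarrow> 'y) \<Rightarrow>
    ('x \<Rightarrow> 'y) \<Rightarrow> enat" where
  "g_secat G X \<alpha> Y \<beta> q = Inf {enat k | k. k \<ge> 1 \<and>
     (\<exists>U. (\<Union>i\<in>{1..k}. U i) = topspace Y \<and>
        (\<forall>i\<in>{1..k}. openin Y (U i) \<and> invariant_under (carrier G) \<beta> (U i) \<and>
           (\<exists>s. g_map G (subtopology Y (U i)) \<beta> X \<alpha> s \<and>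
                g_homotopic G (subtopology Y (U i)) \<beta> Y \<beta> (q \<circ> s) id)))}"

text \<open>
  The continuous maps from \<open>X\<close> to \<open>Y\<close> are represented by their extensional representatives, which
  makes equality of maps equality on \<open>topspace X\<close>.
\<close>

definition compact_open_topology :: "'x topology \<Rightarrow> 'y topology \<Rightarrow> ('x \<Rightarrow> 'y) topology" where
  "compact_open_topology X Y = topology_generated_by
     {{f \<in> extensional (topspace X). continuous_map X Y f \<and> f ` C \<subseteq> V} | C V.
        compactin X C \<and> openin Y V}"

definition path_action :: "('g \<Rightarrow> 'x \<Rightarrow> 'x) \<Rightarrow> 'g \<Rightarrow> (real \<Rightarrow> 'x) \<Rightarrow> real \<Rightarrow> 'x" where
  "path_action \<alpha> g \<gamma> = (\<lambda>t\<in>{0..1}. \<alpha> g (\<gamma> t))"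

definition fibre_path_space ::
  "'e topology \<Rightarrow> 'b topology \<Rightarrow> ('e \<Rightarrow> 'b) \<Rightarrow> (real \<Rightarrow> 'e) topology" where
  "fibre_path_space E B p = subtopology (compact_open_topology unit_interval E)
     {\<gamma>. \<exists>b\<in>topspace B. \<forall>t\<in>{0..1}. p (\<gamma> t) = b}"

definition fibre_product :: "'e topology \<Rightarrow> ('e \<Rightarrow> 'b) \<Rightarrow> ('e \<times> 'e) topology" where
  "fibre_product E p = subtopology (prod_topology E E) {(e1, e2). p e1 = p e2}"

definition diagonal_action :: "('g \<Rightarrow> 'x \<Rightarrow> 'x) \<Rightarrow> 'g \<Rightarrow> 'x \<times> 'x \<Rightarrow> 'x \<times> 'x" where
  "diagonal_action \<alpha> g = (\<lambda>(x, y). (\<alpha> g x, \<alpha> g y))"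

definition param_TC ::
  "('g, 'm) monoid_scheme \<Rightarrow> 'e topology \<Rightarrow> ('g \<Rightarrow> 'e \<Rightarrow> 'e) \<Rightarrow> 'b topology \<Rightarrow> ('e \<Rightarrow> 'b) \<Rightarrow> enat" where
  "param_TC G E \<alpha> B p =
     g_secat G (fibre_path_space E B p) (path_action \<alpha>) (fibre_product E p) (diagonal_action \<alpha>)
       (\<lambda>\<gamma>. (\<gamma> 0, \<gamma> 1))"


subsection \<open>Lifting for test spaces of every type\<close>

lemma g_space_action:
  assumes "g_space G T X \<alpha>" "x \<in> topspace X"
  shows "group G"
    and "\<alpha> \<one>\<^bsub>G\<^esub> x = x"
    and "g \<in> carrier G \<Longrightarrow> \<alpha> g x \<in> topspace X"
    and "g \<in> carrier G \<Longrightarrow> h \<in> carrier G \<Longrightarrow> \<alpha> (g \<otimes>\<^bsub>G\<^esub> h) x = \<alpha> g (\<alpha> h x)"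
proof -
  interpret group_action G "topspace X" "\<lambda>g. restrict (\<alpha> g) (topspace X)"
    using assms by (simp add: g_space_def)
  show "group G"
    using group_hom group_hom.axioms(1) by blast
  show "\<alpha> \<one>\<^bsub>G\<^esub> x = x"
    using id_eq_one assms(2) by (metis restrict_apply')
  show el: "\<alpha> g x \<in> topspace X" if "g \<in> carrier G" for g
    using element_image[OF that assms(2)] assms(2) by auto
  show "\<alpha> (g \<otimes>\<^bsub>G\<^esub> h) x = \<alpha> g (\<alpha> h x)" if "g \<in> carrier G" "h \<in> carrier G"
    using composition_rule[OF assms(2) that] el[OF that(2)] assms(2) by simp
qed

lemma g_spaceI:
  assumes G: "group G" and "Hausdorff_space X"
    and one: "\<And>x. x \<in> topspace X \<Longrightarrow> \<alpha> \<one>\<^bsub>G\<^esub> x = x"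
    and cl: "\<And>g x. g \<in> carrier G \<Longrightarrow> x \<in> topspace X \<Longrightarrow> \<alpha> g x \<in> topspace X"
    and mult: "\<And>g h x. g \<in> carrier G \<Longrightarrow> h \<in> carrier G \<Longrightarrow> x \<in> topspace X \<Longrightarrow>
                 \<alpha> (g \<otimes>\<^bsub>G\<^esub> h) x = \<alpha> g (\<alpha> h x)"
    and "continuous_map (prod_topology T X) X (\<lambda>(g, x). \<alpha> g x)"
  shows "g_space G T X \<alpha>"
proof -
  let ?S = "topspace X"
  interpret group G by (rule G)
  have bij: "restrict (\<alpha> g) ?S \<in> Bij ?S" if g: "g \<in> carrier G" for g
  proof -
    have "bij_betw (\<alpha> g) ?S ?S"
    proof (rule bij_betw_byWitness[where f' = "\<alpha> (inv\<^bsub>G\<^esub> g)"])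
      show "\<forall>a\<in>?S. \<alpha> (inv\<^bsub>G\<^esub> g) (\<alpha> g a) = a"
        using mult[of "inv\<^bsub>G\<^esub> g" g] g one by simp
      show "\<forall>a\<in>?S. \<alpha> g (\<alpha> (inv\<^bsub>G\<^esub> g) a) = a"
        using mult[of g "inv\<^bsub>G\<^esub> g"] g one by simp
    qed (use cl g in auto)
    then show ?thesis
      by (simp add: Bij_def bij_betw_restrict_eq)
  qed
  have "(\<lambda>g. restrict (\<alpha> g) ?S) \<in> hom G (BijGroup ?S)"
  proof (rule homI)
    fix g h assume gh: "g \<in> carrier G" "h \<in> carrier G"
    show "restrict (\<alpha> (g \<otimes>\<^bsub>G\<^esub> h)) ?S =
        restrict (\<alpha> g) ?S \<otimes>\<^bsub>BijGroup ?S\<^esub> restrict (\<alpha> h) ?S"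
      using gh bij[OF gh(1)] bij[OF gh(2)] cl mult
      by (auto simp: BijGroup_def compose_def fun_eq_iff)
  qed (use bij in \<open>simp add: BijGroup_def\<close>)
  then have "group_action G ?S (\<lambda>g. restrict (\<alpha> g) ?S)"
    by (simp add: group_action_def group_hom_def group_hom_axioms_def G group_BijGroup)
  then show ?thesis
    using assms by (simp add: g_space_def)
qed

abbreviation path_space :: "'y topology \<Rightarrow> (real \<Rightarrow> 'y) topology" where
  "path_space Y \<equiv> compact_open_topology unit_interval Y"

lemma topspace_path_space:
  "topspace (path_space Y) = {\<gamma> \<in> extensional {0..1}. continuous_map unit_interval Y \<gamma>}"
  (is "_ = ?R")
proof -
  have "{f \<in> extensional (topspace unit_interval). continuous_map unit_interval Y f \<and> f ` {} \<subseteq> {}} \<in>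
      {{f \<in> extensional (topspace unit_interval). continuous_map unit_interval Y f \<and> f ` C \<subseteq> V} | C V.
        compactin unit_interval C \<and> openin Y V}"
    by blast
  then show ?thesis
    unfolding compact_open_topology_def topology_generated_by_topspace by auto
qed

lemma openin_path_space:
  assumes "compactin unit_interval C" "openin Y V"
  shows "openin (path_space Y) {\<gamma> \<in> topspace (path_space Y). \<gamma> ` C \<subseteq> V}"
proof -
  have "{\<gamma> \<in> topspace (path_space Y). \<gamma> ` C \<subseteq> V} =
      {f \<in> extensional (topspace unit_interval). continuous_map unit_interval Y f \<and> f ` C \<subseteq> V}"
    by (auto simp: topspace_path_space)
  also have "openin (path_space Y) \<dots>"
    unfolding compact_open_topology_def
    by (rule topology_generated_by_Basis) (use assms in blast)
  finally show ?thesis .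
qed

lemma path_space_point: "\<gamma> \<in> topspace (path_space Y) \<Longrightarrow> t \<in> {0..1} \<Longrightarrow> \<gamma> t \<in> topspace Y"
  by (auto simp: topspace_path_space continuous_map_def)

lemma Hausdorff_path_space:
  assumes "Hausdorff_space Y"
  shows "Hausdorff_space (path_space Y)"
  unfolding Hausdorff_space_def
proof (intro allI impI, elim conjE)
  fix \<gamma> \<delta> assume *: "\<gamma> \<in> topspace (path_space Y)" "\<delta> \<in> topspace (path_space Y)" "\<gamma> \<noteq> \<delta>"
  then obtain t where t: "t \<in> {0..1}" "\<gamma> t \<noteq> \<delta> t"
    by (metis (no_types, lifting) extensionalityI mem_Collect_eq topspace_path_space)
  obtain U V where UV: "openin Y U" "openin Y V" "\<gamma> t \<in> U" "\<delta> t \<in> V" "disjnt U V"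
    using assms t path_space_point * unfolding Hausdorff_space_def by metis
  let ?N = "\<lambda>U. {\<gamma> \<in> topspace (path_space Y). \<gamma> ` {t} \<subseteq> U}"
  have "compactin unit_interval {t}" using t by simp
  then have "openin (path_space Y) (?N U)" "openin (path_space Y) (?N V)"
    using openin_path_space UV by blast+
  moreover have "disjnt (?N U) (?N V)" "\<gamma> \<in> ?N U" "\<delta> \<in> ?N V"
    using UV * by (auto simp: disjnt_def)
  ultimately show "\<exists>U V. openin (path_space Y) U \<and> openin (path_space Y) V \<and> \<gamma> \<in> U \<and> \<delta> \<in> V \<and> disjnt U V"
    by blast
qed

lemma continuous_map_eval_path:
  "continuous_map (cylinder (path_space Y)) Y (\<lambda>(t, \<gamma>). \<gamma> t)"
proof -
  show ?thesis
    unfolding continuous_map_eq_topcontinuous_at topcontinuous_at_def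
  proof (intro ballI conjI allI impI)
    fix z assume z: "z \<in> topspace (cylinder (path_space Y))"
    then obtain t \<gamma> where z_eq: "z = (t, \<gamma>)" and t: "t \<in> {0..1}" and g: "\<gamma> \<in> topspace (path_space Y)"
      by auto
    show "z \<in> topspace (cylinder (path_space Y))" by fact
    show "(\<lambda>(t, \<gamma>). \<gamma> t) \<in> topspace (cylinder (path_space Y)) \<rightarrow> topspace Y"
    proof
      fix y assume "y \<in> topspace (cylinder (path_space Y))"
      then show "(case y of (t, \<gamma>) \<Rightarrow> \<gamma> t) \<in> topspace Y"
        using path_space_point[of "snd y" Y "fst y"] by (simp add: case_prod_unfold mem_Times_iff)
    qed
    fix V assume V: "openin Y V \<and> (case z of (t, \<gamma>) \<Rightarrow> \<gamma> t) \<in> V"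
    define W where "W = {s \<in> topspace unit_interval. \<gamma> s \<in> V}"
    have W: "openin unit_interval W"
      using g V unfolding W_def topspace_path_space
      by (intro openin_continuous_map_preimage[of _ Y]) auto
    have "locally_compact_space unit_interval"
      by (intro compact_imp_locally_compact_space) (simp add: compact_space_subtopology)
    then have "neighbourhood_base_of (compactin unit_interval) unit_interval"
      by (simp add: locally_compact_space_neighbourhood_base Hausdorff_space_subtopology)
    moreover have "t \<in> W"
      using t V z_eq by (simp add: W_def)
    ultimately obtain N C where N: "openin unit_interval N" "compactin unit_interval C" "t \<in> N" "N \<subseteq> C" "C \<subseteq> W"
      using W unfolding neighbourhood_base_of by meson
    let ?U = "N \<times> {\<gamma> \<in> topspace (path_space Y). \<gamma> ` C \<subseteq> V}"
    have "openin (cylinder (path_space Y)) ?U"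
      using openin_path_space[OF N(2) V[THEN conjunct1]] N(1) by (simp add: openin_prod_Times_iff)
    moreover have "z \<in> ?U"
      using z_eq N g by (auto simp: W_def)
    moreover have "\<forall>y\<in>?U. (case y of (t, \<gamma>) \<Rightarrow> \<gamma> t) \<in> V"
      using N by auto
    ultimately show "\<exists>U. openin (cylinder (path_space Y)) U \<and> z \<in> U \<and> (\<forall>y\<in>U. (case y of (t, \<gamma>) \<Rightarrow> \<gamma> t) \<in> V)"
      by blast
  qed
qed

lemma continuous_map_into_path_space:
  assumes h: "continuous_map (cylinder X) Y h"
  shows "continuous_map X (path_space Y) (\<lambda>x. \<lambda>t\<in>{0..1}. h (t, x))"
  unfolding compact_open_topology_def
proof (rule continuous_on_generated_topo)
  let ?c = "\<lambda>x. \<lambda>t\<in>{0..1}. h (t, x)"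
  have cont: "continuous_map unit_interval Y (?c x)" if "x \<in> topspace X" for x
  proof -
    have "continuous_map unit_interval Y (h \<circ> (\<lambda>t. (t, x)))"
      by (rule continuous_map_compose[OF _ h]) (use that in \<open>auto intro!: continuous_intros\<close>)
    then show ?thesis
      by (rule continuous_map_eq) auto
  qed
  show "?c ` topspace X \<subseteq> \<Union> {{f \<in> extensional (topspace unit_interval). continuous_map unit_interval Y f \<and> f ` C \<subseteq> V} | C V.
        compactin unit_interval C \<and> openin Y V}"
    using topspace_path_space[of Y] cont
    unfolding compact_open_topology_def topology_generated_by_topspace by auto
  fix S assume "S \<in> {{f \<in> extensional (topspace unit_interval). continuous_map unit_interval Y f \<and> f ` C \<subseteq> V} | C V.
        compactin unit_interval C \<and> openin Y V}"
  then obtain C V where S: "S = {f \<in> extensional (topspace unit_interval). continuous_map unit_interval Y f \<and> f ` C \<subseteq> V}"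
    and C: "compactin unit_interval C" and V: "openin Y V" by blast
  have C01: "C \<subseteq> {0..1}" using compactin_subset_topspace[OF C] by simp
  define W where "W = {z \<in> topspace (cylinder X). h z \<in> V}"
  have W: "openin (cylinder X) W"
    unfolding W_def using h V by (rule openin_continuous_map_preimage)
  show "openin X (?c -` S \<inter> topspace X)"
  proof (subst openin_subopen, intro ballI)
    fix x assume x: "x \<in> ?c -` S \<inter> topspace X"
    have "C \<times> {x} \<subseteq> W"
      using x C01 by (force simp: S W_def)
    moreover have "compactin X {x}" using x by simp
    ultimately obtain N M where NM: "openin unit_interval N" "openin X M" "C \<subseteq> N" "{x} \<subseteq> M" "N \<times> M \<subseteq> W"
      using Wallace_theorem_prod_topology[OF C _ W, of "{x}"] by blast
    have "M \<subseteq> ?c -` S \<inter> topspace X"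
    proof
      fix y assume y: "y \<in> M"
      then have "y \<in> topspace X" using NM(2) openin_subset by blast
      moreover have "?c y ` C \<subseteq> V"
        using NM y C01 by (force simp: W_def)
      ultimately show "y \<in> ?c -` S \<inter> topspace X"
        using cont by (auto simp: S)
    qed
    then show "\<exists>T. openin X T \<and> x \<in> T \<and> T \<subseteq> ?c -` S \<inter> topspace X"
      using NM by blast
  qed
qed

lemma g_fibration_homotopy_lifting:
  fixes X :: "'x topology" and E :: "'e topology" and B :: "'b topology"
  assumes fib: "g_fibration G T E \<alpha> B \<beta> p" and T: "topspace T = carrier G"
    and X: "g_space G T X \<xi>"
  shows "g_homotopy_lifting G X \<xi> E \<alpha> B \<beta> p"
proof (cases "topspace X = {}")
  case True
  have "k \<in> Collect (g_map G (cylinder X) (cylinder_action \<xi>) E \<alpha>)" for k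
    using True by (auto simp: g_map_def equivariant_on_def continuous_map_def)
  then show ?thesis
    using True by (auto simp: g_homotopy_lifting_def)
next
  case False
  have E: "g_space G T E \<alpha>" and B: "g_space G T B \<beta>" and p: "g_map G E \<alpha> B \<beta> p"
    using fib by (auto simp: g_fibration_def)
  have G: "group G"
  proof -
    obtain x where "x \<in> topspace X" using False by blast
    then show ?thesis by (rule g_space_action(1)[OF X])
  qed
  define Z where "Z = subtopology (prod_topology E (path_space B)) {(e, \<gamma>). p e = \<gamma> 0}"
  define \<zeta> where "\<zeta> = (\<lambda>g (e, \<gamma>). (\<alpha> g e, path_action \<beta> g \<gamma>))"
  have Z_iff: "(e, \<gamma>) \<in> topspace Z \<longleftrightarrow> e \<in> topspace E \<and> \<gamma> \<in> topspace (path_space B) \<and> p e = \<gamma> 0" for e \<gamma>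
    by (simp add: Z_def)
  have contE: "continuous_map (prod_topology T E) E (\<lambda>(g, x). \<alpha> g x)"
    and contB: "continuous_map (prod_topology T B) B (\<lambda>(g, x). \<beta> g x)"
    using E B by (auto simp: g_space_def)
  have eval: "continuous_map Y B (\<lambda>y. b y (a y))"
    if "continuous_map Y unit_interval a" "continuous_map Y (path_space B) b" for Y :: "'y topology" and a b
    using continuous_map_compose[OF continuous_map_pairedI[OF that] continuous_map_eval_path]
    by (simp add: o_def)
  have ZE: "continuous_map Z E fst" and ZB: "continuous_map Z (path_space B) snd"
    unfolding Z_def
    by (auto intro: continuous_map_from_subtopology continuous_map_fst continuous_map_snd)

  have path_cont: "continuous_map (prod_topology T Z) (path_space B) (\<lambda>x. path_action \<beta> (fst x) (snd (snd x)))"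
  proof -
    let ?C = "cylinder (prod_topology T Z)"
    have 1: "continuous_map ?C T (\<lambda>x. fst (snd x))" and 2: "continuous_map ?C Z (\<lambda>x. snd (snd x))"
      using continuous_map_compose[OF continuous_map_snd continuous_map_fst]
        continuous_map_compose[OF continuous_map_snd continuous_map_snd]
      by (auto simp: o_def)
    have 3: "continuous_map ?C B (\<lambda>x. (snd (snd (snd x))) (fst x))"
      using continuous_map_compose[OF 2 ZB]
      by (intro eval continuous_map_fst) (simp add: o_def)
    have "continuous_map ?C B (\<lambda>x. \<beta> (fst (snd x)) ((snd (snd (snd x))) (fst x)))"
      using continuous_map_compose[OF continuous_map_pairedI[OF 1 3] contB] by (simp add: o_def)
    from continuous_map_into_path_space[OF this]
    show ?thesis by (simp add: path_action_def)
  qed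
  have E_cont: "continuous_map (prod_topology T Z) E (\<lambda>x. \<alpha> (fst x) (fst (snd x)))"
    using continuous_map_compose[OF continuous_map_pairedI[OF continuous_map_fst
          continuous_map_compose[OF continuous_map_snd ZE]] contE]
    by (simp add: o_def)
  have cl: "\<zeta> g z \<in> topspace Z" if "g \<in> carrier G" "z \<in> topspace Z" for g z
  proof -
    obtain e \<gamma> where z: "z = (e, \<gamma>)" by force
    have "(g, z) \<in> topspace (prod_topology T Z)" using that T by simp
    then have "path_action \<beta> g \<gamma> \<in> topspace (path_space B)"
      using continuous_map_image_subset_topspace[OF path_cont] z by fastforce
    moreover have "\<alpha> g e \<in> topspace E"
      using that z Z_iff g_space_action(3)[OF E] by blast
    moreover have "p (\<alpha> g e) = path_action \<beta> g \<gamma> 0"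
      using p that z Z_iff[of e \<gamma>] by (simp add: g_map_def equivariant_on_def path_action_def)
    ultimately show ?thesis by (simp add: z \<zeta>_def Z_iff)
  qed
  have Z: "g_space G T Z \<zeta>"
  proof (rule g_spaceI[OF G])
    show "Hausdorff_space Z"
      using E B unfolding Z_def g_space_def
      by (intro Hausdorff_space_subtopology) (simp add: Hausdorff_space_prod_topology Hausdorff_path_space)
    show "\<zeta> \<one>\<^bsub>G\<^esub> z = z" if "z \<in> topspace Z" for z
    proof -
      obtain e \<gamma> where z: "z = (e, \<gamma>)" by force
      then have "e \<in> topspace E" "\<gamma> \<in> topspace (path_space B)" using that Z_iff by auto
      moreover from this(2) have "path_action \<beta> \<one>\<^bsub>G\<^esub> \<gamma> = \<gamma>"
        using g_space_action(2)[OF B path_space_point]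
        by (intro extensionalityI[of _ "{0..1}"]) (auto simp: path_action_def topspace_path_space)
      ultimately show ?thesis
        using g_space_action(2)[OF E] by (simp add: z \<zeta>_def)
    qed
    show "\<zeta> (g \<otimes>\<^bsub>G\<^esub> h) z = \<zeta> g (\<zeta> h z)"
      if gh: "g \<in> carrier G" "h \<in> carrier G" and "z \<in> topspace Z" for g h z
    proof -
      obtain e \<gamma> where z: "z = (e, \<gamma>)" by force
      then have "e \<in> topspace E" "\<gamma> \<in> topspace (path_space B)" using that Z_iff by auto
      moreover from this(2) have "path_action \<beta> (g \<otimes>\<^bsub>G\<^esub> h) \<gamma> = path_action \<beta> g (path_action \<beta> h \<gamma>)"
        using g_space_action(4)[OF B path_space_point gh]
        by (auto simp: path_action_def fun_eq_iff)
      ultimately show ?thesis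
        using g_space_action(4)[OF E _ gh] by (simp add: z \<zeta>_def)
    qed
    have "continuous_map (prod_topology T Z) Z (\<lambda>x. (\<alpha> (fst x) (fst (snd x)), path_action \<beta> (fst x) (snd (snd x))))"
    proof -
      have "p (\<alpha> g e) = path_action \<beta> g \<gamma> 0" if "g \<in> topspace T" "(e, \<gamma>) \<in> topspace Z" for g e \<gamma>
        using cl[of g "(e, \<gamma>)"] that T by (simp add: \<zeta>_def Z_iff)
      then have "(\<lambda>x. (\<alpha> (fst x) (fst (snd x)), path_action \<beta> (fst x) (snd (snd x)))) \<in>
          topspace (prod_topology T Z) \<rightarrow> {(e, \<gamma>). p e = \<gamma> 0}"
        by auto
      then show ?thesis
        using continuous_map_pairedI[OF E_cont path_cont]
        by (subst (2) Z_def) (simp add: continuous_map_in_subtopology image_subset_iff_funcset)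
    qed
    then show "continuous_map (prod_topology T Z) Z (\<lambda>(g, z). \<zeta> g z)"
      by (simp add: \<zeta>_def case_prod_unfold)
  qed (rule cl)
  have "g_homotopy_lifting G Z \<zeta> E \<alpha> B \<beta> p"
    using fib Z by (simp add: g_fibration_def)
  moreover have "g_map G Z \<zeta> E \<alpha> fst"
    using ZE by (auto simp: g_map_def equivariant_on_def \<zeta>_def)
  moreover have "g_map G (cylinder Z) (cylinder_action \<zeta>) B \<beta> (\<lambda>(t, z). snd z t)"
  proof -
    have "continuous_map (cylinder Z) B (\<lambda>x. (snd (snd x)) (fst x))"
      using continuous_map_compose[OF continuous_map_snd ZB]
      by (intro eval continuous_map_fst) (simp add: o_def)
    then show ?thesis
      by (auto simp: g_map_def equivariant_on_def \<zeta>_def path_action_def case_prod_unfold)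
  qed
  moreover have "\<forall>z\<in>topspace Z. (\<lambda>(t, z). snd z t) (0, z) = p (fst z)"
    by (auto simp: Z_iff)
  ultimately obtain L where L: "g_map G (cylinder Z) (cylinder_action \<zeta>) E \<alpha> L"
    "\<forall>z\<in>topspace Z. L (0, z) = fst z"
    "\<forall>t\<in>{0..1}. \<forall>z\<in>topspace Z. p (L (t, z)) = snd z t"
    unfolding g_homotopy_lifting_def by (smt (verit) case_prod_conv)
  show ?thesis
    unfolding g_homotopy_lifting_def
  proof (intro allI impI, elim conjE)
    fix f h
    assume f: "g_map G X \<xi> E \<alpha> f" and h: "g_map G (cylinder X) (cylinder_action \<xi>) B \<beta> h"
      and h0: "\<forall>x\<in>topspace X. h (0, x) = p (f x)"
    define \<phi> where "\<phi> = (\<lambda>x. (f x, \<lambda>t\<in>{0..1}. h (t, x)))"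
    have \<phi>: "continuous_map X Z \<phi>"
      unfolding Z_def \<phi>_def continuous_map_in_subtopology
      using f h h0 by (auto simp: g_map_def intro!: continuous_map_pairedI continuous_map_into_path_space)
    have \<phi>_eq: "\<phi> (\<xi> g x) = \<zeta> g (\<phi> x)" if "g \<in> carrier G" "x \<in> topspace X" for g x
      using f h that by (auto simp: \<phi>_def \<zeta>_def path_action_def g_map_def equivariant_on_def fun_eq_iff)
    have \<phi>_in: "\<phi> x \<in> topspace Z" if "x \<in> topspace X" for x
      using \<phi> that by (auto simp: continuous_map_def)
    let ?k = "\<lambda>(t, x). L (t, \<phi> x)"
    have "continuous_map (cylinder X) E (\<lambda>y. L (fst y, \<phi> (snd y)))"
      using continuous_map_compose[OF continuous_map_pairedI[OF continuous_map_fst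
            continuous_map_compose[OF continuous_map_snd \<phi>]], of unit_interval E L] L(1)
      by (simp add: o_def g_map_def)
    moreover have "L (t, \<phi> (\<xi> g x)) = \<alpha> g (L (t, \<phi> x))"
      if "g \<in> carrier G" "x \<in> topspace X" "t \<in> {0..1}" for g x t
      using L(1) that \<phi>_in[OF that(2)] \<phi>_eq[OF that(1,2)]
      by (auto simp: g_map_def equivariant_on_def)
    ultimately have "g_map G (cylinder X) (cylinder_action \<xi>) E \<alpha> ?k"
      by (auto simp: g_map_def equivariant_on_def case_prod_unfold)
    moreover have "\<forall>x\<in>topspace X. ?k (0, x) = f x"
      using L(2) \<phi>_in by (simp add: \<phi>_def)
    moreover have "\<forall>t\<in>{0..1}. \<forall>x\<in>topspace X. p (?k (t, x)) = h (t, x)"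
      using L(3) \<phi>_in by (simp add: \<phi>_def)
    ultimately show "\<exists>k. g_map G (cylinder X) (cylinder_action \<xi>) E \<alpha> k \<and>
        (\<forall>x\<in>topspace X. k (0, x) = f x) \<and> (\<forall>t\<in>{0..1}. \<forall>x\<in>topspace X. p (k (t, x)) = h (t, x))"
      by blast
  qed
qed

end

theory Submission
  imports Defs
begin

text \<open>
  A \<open>G\<close>-map sends points fixed by \<open>H\<close> to points fixed by \<open>H\<close>, and on these it is still equivariant
  for \<open>K\<close>. The same applies to a \<open>G\<close>-homotopy, which is a \<open>G\<close>-map on a cylinder with trivial action
  on the interval. Hence a cover of \<open>Y\<close> by invariant open sets with homotopy sections of
  \<open>q : X \<rightarrow> Y\<close> restricts to such a cover of \<open>Y\<^sup>H\<close> for \<open>q\<^sup>H : X\<^sup>H \<rightarrow> Y\<^sup>H\<close>, and passing to \<open>H\<close>-fixed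
  points cannot increase the equivariant sectional category (\<open>g_secat_fixed_space_le\<close>). The \<open>K\<close>-invariance
  of \<open>Y\<^sup>H\<close> is what makes the restricted open sets \<open>K\<close>-invariant.

  It remains to see that the path fibration of \<open>p\<^sup>H\<close> is the \<open>H\<close>-fixed part of the path fibration
  of \<open>p\<close>. For \<open>E \<times>\<^sub>B E\<close> this is immediate. A path is fixed by \<open>H\<close> iff each of its points is,
  so the fixed paths form, as a set, the fibrewise paths of \<open>E\<^sup>H\<close>; the topologies agree because forming path
  spaces commutes with passing to subspaces, a consequence of the exponential law for the
  compact interval.
\<close>

section \<open>Fixed points of equivariant maps and homotopies\<close>

lemma topspace_fixed_space:
  "topspace (fixed_space X \<alpha> H) = {x \<in> topspace X. \<forall>h\<in>H. \<alpha> h x = x}"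
  by (auto simp: fixed_space_def)

lemma subtopology_eqI:
  assumes "\<And>x. x \<in> topspace X \<Longrightarrow> x \<in> S \<longleftrightarrow> x \<in> S'"
  shows "subtopology X S = subtopology X S'"
proof -
  have "topspace X \<inter> S = topspace X \<inter> S'"
    using assms by blast
  then show ?thesis
    by (metis subtopology_restrict)
qed

lemma fixed_space_subtopology:
  "fixed_space (subtopology X S) \<alpha> H = subtopology (fixed_space X \<alpha> H) S"
  unfolding fixed_space_def subtopology_subtopology
  by (rule subtopology_eqI) auto

lemma fixed_space_cylinder:
  "fixed_space (cylinder X) (cylinder_action \<alpha>) H = cylinder (fixed_space X \<alpha> H)"
proof -
  have "cylinder (fixed_space X \<alpha> H) =
      subtopology (cylinder X) (UNIV \<times> {x \<in> topspace X. \<forall>h\<in>H. \<alpha> h x = x})"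
    by (simp add: fixed_space_def subtopology_Times)
  also have "\<dots> = fixed_space (cylinder X) (cylinder_action \<alpha>) H"
    unfolding fixed_space_def by (rule subtopology_eqI) auto
  finally show ?thesis by simp
qed

lemma g_map_fixed_space:
  assumes f: "g_map G X \<alpha> Y \<beta> f" and H: "H \<subseteq> carrier G" and K: "K \<subseteq> carrier G"
  shows "g_map (subgroup_of G K) (fixed_space X \<alpha> H) \<alpha> (fixed_space Y \<beta> H) \<beta> f"
proof -
  have cont: "continuous_map X Y f" and eq: "\<forall>g\<in>carrier G. \<forall>x\<in>topspace X. f (\<alpha> g x) = \<beta> g (f x)"
    using f by (auto simp: g_map_def equivariant_on_def)
  have "f x \<in> topspace (fixed_space Y \<beta> H)" if x: "x \<in> topspace (fixed_space X \<alpha> H)" for x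
  proof -
    have "\<beta> h (f x) = f x" if "h \<in> H" for h
      using eq x H that by (metis (mono_tags, lifting) mem_Collect_eq subsetD topspace_fixed_space)
    then show ?thesis
      using continuous_map_image_subset_topspace[OF cont] x by (auto simp: topspace_fixed_space)
  qed
  then have "continuous_map (fixed_space X \<alpha> H) (fixed_space Y \<beta> H) f"
    using cont unfolding fixed_space_def
    by (auto simp: continuous_map_in_subtopology continuous_map_from_subtopology)
  then show ?thesis
    using eq K by (auto simp: g_map_def equivariant_on_def topspace_fixed_space)
qed

text \<open>
  Viewing a \<open>G\<close>-homotopy as one \<open>G\<close>-map on the cylinder lets facts about \<open>G\<close>-maps apply to it.
\<close>

lemma g_homotopic_iff_g_map:
  "g_homotopic G X \<alpha> Y \<beta> f g \<longleftrightarrow>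
     (\<exists>h. g_map G (cylinder X) (cylinder_action \<alpha>) Y \<beta> h \<and>
          (\<forall>x. h (0, x) = f x) \<and> (\<forall>x. h (1, x) = g x))"
proof -
  have "equivariant_on G (topspace (cylinder X)) (cylinder_action \<alpha>) \<beta> h \<longleftrightarrow>
      (\<forall>t\<in>{0..1}. equivariant_on G (topspace X) \<alpha> \<beta> (\<lambda>x. h (t, x)))" for h
    unfolding equivariant_on_def topspace_prod_topology topspace_euclidean_subtopology
    by fastforce
  then show ?thesis
    unfolding g_homotopic_def homotopic_with_def g_map_def by (simp only: conj_ac)
qed

lemma g_homotopic_fixed_space:
  assumes "g_homotopic G X \<alpha> Y \<beta> f g" and "H \<subseteq> carrier G" and "K \<subseteq> carrier G"
  shows "g_homotopic (subgroup_of G K) (fixed_space X \<alpha> H) \<alpha> (fixed_space Y \<beta> H) \<beta> f g"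
proof -
  obtain h where h: "g_map G (cylinder X) (cylinder_action \<alpha>) Y \<beta> h"
    and ends: "\<forall>x. h (0, x) = f x" "\<forall>x. h (1, x) = g x"
    using assms(1) unfolding g_homotopic_iff_g_map by blast
  from g_map_fixed_space[OF h assms(2,3)] ends show ?thesis
    unfolding g_homotopic_iff_g_map fixed_space_cylinder by blast
qed

section \<open>Sectional category of the restriction to fixed points\<close>

lemma g_secat_fixed_space_le:
  assumes H: "H \<subseteq> carrier G" and K: "K \<subseteq> carrier G"
    and inv: "invariant_under K \<beta> (topspace (fixed_space Y \<beta> H))"
  shows "g_secat (subgroup_of G K) (fixed_space X \<alpha> H) \<alpha> (fixed_space Y \<beta> H) \<beta> q
           \<le> g_secat G X \<alpha> Y \<beta> q"
  unfolding g_secat_def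
proof (rule Inf_superset_mono, rule subsetI, clarify)
  let ?Y = "fixed_space Y \<beta> H"
  fix k :: nat and U
  assume k: "k \<ge> 1" and cover: "(\<Union>i\<in>{1..k}. U i) = topspace Y"
    and U: "\<forall>i\<in>{1..k}. openin Y (U i) \<and> invariant_under (carrier G) \<beta> (U i) \<and>
           (\<exists>s. g_map G (subtopology Y (U i)) \<beta> X \<alpha> s \<and>
                g_homotopic G (subtopology Y (U i)) \<beta> Y \<beta> (q \<circ> s) id)"
  let ?V = "\<lambda>i. topspace ?Y \<inter> U i"
  have sub: "subtopology ?Y (?V i) = fixed_space (subtopology Y (U i)) \<beta> H" for i
    unfolding fixed_space_subtopology by (rule subtopology_restrict)
  have cover_V: "(\<Union>i\<in>{1..k}. ?V i) = topspace ?Y"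
    using cover by (auto simp: topspace_fixed_space)
  have V: "openin ?Y (?V i) \<and> invariant_under (carrier (subgroup_of G K)) \<beta> (?V i) \<and>
      (\<exists>s. g_map (subgroup_of G K) (subtopology ?Y (?V i)) \<beta> (fixed_space X \<alpha> H) \<alpha> s \<and>
           g_homotopic (subgroup_of G K) (subtopology ?Y (?V i)) \<beta> ?Y \<beta> (q \<circ> s) id)"
    if i: "i \<in> {1..k}" for i
  proof (intro conjI)
    have open_U: "openin Y (U i)" and inv_U: "invariant_under (carrier G) \<beta> (U i)"
      using bspec[OF U i] by simp_all
    have "?V i = U i \<inter> {y \<in> topspace Y. \<forall>h\<in>H. \<beta> h y = y}"
      unfolding topspace_fixed_space by (rule Int_commute)
    then show "openin ?Y (?V i)"
      using open_U by (simp add: fixed_space_def openin_subtopology_Int)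
    show "invariant_under (carrier (subgroup_of G K)) \<beta> (?V i)"
      using inv_U inv K by (auto simp: invariant_under_def)
    obtain s where s: "g_map G (subtopology Y (U i)) \<beta> X \<alpha> s"
      and qs: "g_homotopic G (subtopology Y (U i)) \<beta> Y \<beta> (q \<circ> s) id"
      using bspec[OF U i] by (elim conjE exE)
    show "\<exists>s. g_map (subgroup_of G K) (subtopology ?Y (?V i)) \<beta> (fixed_space X \<alpha> H) \<alpha> s \<and>
        g_homotopic (subgroup_of G K) (subtopology ?Y (?V i)) \<beta> ?Y \<beta> (q \<circ> s) id"
      unfolding sub
      by (intro exI[of _ s] conjI g_map_fixed_space[OF s H K] g_homotopic_fixed_space[OF qs H K])
  qed
  show "\<exists>k'. enat k = enat k' \<and> k' \<ge> 1 \<and>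
     (\<exists>U. (\<Union>i\<in>{1..k'}. U i) = topspace ?Y \<and>
        (\<forall>i\<in>{1..k'}. openin ?Y (U i) \<and> invariant_under (carrier (subgroup_of G K)) \<beta> (U i) \<and>
           (\<exists>s. g_map (subgroup_of G K) (subtopology ?Y (U i)) \<beta> (fixed_space X \<alpha> H) \<alpha> s \<and>
                g_homotopic (subgroup_of G K) (subtopology ?Y (U i)) \<beta> ?Y \<beta> (q \<circ> s) id)))"
    by (rule exI[of _ k], rule conjI[OF refl], rule conjI[OF k], rule exI[of _ ?V],
        rule conjI[OF cover_V], rule ballI, rule V)
qed

section \<open>Path spaces of subspaces\<close>

text \<open>
  The exponential law for the interval. One direction is joint continuity of evaluation, which
  rests on the local compactness of the interval; the other is the tube lemma, applied to the
  compact subsets of the interval that define the subbasis.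
\<close>

lemma continuous_map_path_space_iff:
  "continuous_map X (path_space Y) s \<longleftrightarrow>
     s ` topspace X \<subseteq> extensional {0..1} \<and> continuous_map (cylinder X) Y (\<lambda>(t, x). s x t)"
proof (intro iffI conjI)
  assume s: "continuous_map X (path_space Y) s"
  show "s ` topspace X \<subseteq> extensional {0..1}"
    using continuous_map_image_subset_topspace[OF s] by (auto simp: topspace_path_space)
  show "continuous_map (cylinder X) Y (\<lambda>(t, x). s x t)"
    using continuous_map_compose[OF continuous_map_pairedI[OF continuous_map_fst
          continuous_map_compose[OF continuous_map_snd s]] continuous_map_eval_path]
    by (simp add: o_def case_prod_unfold)
next
  assume s: "s ` topspace X \<subseteq> extensional {0..1} \<and> continuous_map (cylinder X) Y (\<lambda>(t, x). s x t)"
  have "continuous_map X (path_space Y) (\<lambda>x. \<lambda>t\<in>{0..1}. (\<lambda>(t, x). s x t) (t, x))"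
    using s by (intro continuous_map_into_path_space) blast
  then show "continuous_map X (path_space Y) s"
    by (rule continuous_map_eq) (use s in \<open>auto simp: extensional_restrict\<close>)
qed

text \<open>
  By the exponential law, continuity into either side is continuity of a map into \<open>Y\<close>
  with values in \<open>S\<close>, so the identity is continuous in both directions.
\<close>

lemma path_space_subtopology:
  "path_space (subtopology Y S) = subtopology (path_space Y) {\<gamma>. \<forall>t\<in>{0..1}. \<gamma> t \<in> S}"
    (is "?P = ?Q")
proof -
  have "continuous_map ?P (path_space Y) id"
    using continuous_map_path_space_iff[of ?P "subtopology Y S" id]
    by (simp add: continuous_map_path_space_iff continuous_map_in_subtopology)
  then have PQ: "continuous_map ?P ?Q id"
    using path_space_point[of _ "subtopology Y S"] by (auto simp: continuous_map_in_subtopology)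
  have "continuous_map ?Q (path_space Y) id"
    by (simp add: continuous_map_from_subtopology)
  then have QP: "continuous_map ?Q ?P id"
    by (auto simp: continuous_map_path_space_iff continuous_map_in_subtopology)
  have "homeomorphic_maps ?P ?Q id id"
    using PQ QP by (simp add: homeomorphic_maps_def)
  then have "homeomorphic_map ?P ?Q id"
    by (rule homeomorphic_maps_imp_map)
  then show ?thesis
    by simp
qed

section \<open>The path fibration of the fixed point map\<close>

text \<open>
  That \<open>p\<close> sends fixed points to fixed points puts the common image of a fixed fibrewise path into
  the base of the fixed point map.
\<close>

lemma fixed_space_fibre_path_space:
  assumes p: "p ` topspace (fixed_space E \<alpha> H) \<subseteq> topspace (fixed_space B \<beta> H)"
  shows "fixed_space (fibre_path_space E B p) (path_action \<alpha>) H =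
           fibre_path_space (fixed_space E \<alpha> H) (fixed_space B \<beta> H) p"
proof -
  let ?S = "{x \<in> topspace E. \<forall>h\<in>H. \<alpha> h x = x}"
  have fixed: "path_action \<alpha> h \<gamma> = \<gamma> \<longleftrightarrow> (\<forall>t\<in>{0..1}. \<alpha> h (\<gamma> t) = \<gamma> t)"
    if \<gamma>: "\<gamma> \<in> extensional {0..1}" for h \<gamma>
  proof
    assume "path_action \<alpha> h \<gamma> = \<gamma>"
    then show "\<forall>t\<in>{0..1}. \<alpha> h (\<gamma> t) = \<gamma> t"
      by (metis path_action_def restrict_apply')
  next
    assume "\<forall>t\<in>{0..1}. \<alpha> h (\<gamma> t) = \<gamma> t"
    then have "path_action \<alpha> h \<gamma> = restrict \<gamma> {0..1}"
      unfolding path_action_def by (intro restrict_ext) blast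
    then show "path_action \<alpha> h \<gamma> = \<gamma>"
      using \<gamma> by (simp add: extensional_restrict)
  qed
  have base: "(\<exists>b\<in>topspace (fixed_space B \<beta> H). \<forall>t\<in>{0..1}. p (\<gamma> t) = b) \<longleftrightarrow>
      (\<exists>b\<in>topspace B. \<forall>t\<in>{0..1}. p (\<gamma> t) = b)" if "\<forall>t\<in>{0..1}. \<gamma> t \<in> ?S" for \<gamma> :: "real \<Rightarrow> _"
  proof -
    have "\<gamma> 0 \<in> topspace (fixed_space E \<alpha> H)"
      using that by (simp add: topspace_fixed_space)
    then have p0: "p (\<gamma> 0) \<in> topspace (fixed_space B \<beta> H)"
      using p by blast
    have sub: "topspace (fixed_space B \<beta> H) \<subseteq> topspace B"
      by (auto simp: topspace_fixed_space)
    show ?thesis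
    proof
      assume "\<exists>b\<in>topspace B. \<forall>t\<in>{0..1}. p (\<gamma> t) = b"
      then obtain b where b: "\<forall>t\<in>{0..1}. p (\<gamma> t) = b"
        by (elim bexE)
      then have "p (\<gamma> 0) = b"
        by simp
      with p0 have "b \<in> topspace (fixed_space B \<beta> H)"
        by simp
      with b show "\<exists>b\<in>topspace (fixed_space B \<beta> H). \<forall>t\<in>{0..1}. p (\<gamma> t) = b"
        by (rule bexI)
    qed (rule bexE, assumption, rule bexI, assumption, rule subsetD[OF sub])
  qed
  have "fibre_path_space (fixed_space E \<alpha> H) (fixed_space B \<beta> H) p =
      subtopology (path_space E) ({\<gamma>. \<forall>t\<in>{0..1}. \<gamma> t \<in> ?S} \<inter>
        {\<gamma>. \<exists>b\<in>topspace (fixed_space B \<beta> H). \<forall>t\<in>{0..1}. p (\<gamma> t) = b})"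
    unfolding fibre_path_space_def fixed_space_def[of E] path_space_subtopology subtopology_subtopology
    by (rule refl)
  also have "\<dots> = fixed_space (fibre_path_space E B p) (path_action \<alpha>) H"
    unfolding fixed_space_def[of "fibre_path_space E B p"] unfolding fibre_path_space_def subtopology_subtopology
  proof (rule subtopology_eqI)
    fix \<gamma> assume \<gamma>: "\<gamma> \<in> topspace (path_space E)"
    then have ext: "\<gamma> \<in> extensional {0..1}"
      by (simp add: topspace_path_space)
    have S: "(\<forall>t\<in>{0..1}. \<gamma> t \<in> ?S) \<longleftrightarrow> (\<forall>h\<in>H. path_action \<alpha> h \<gamma> = \<gamma>)"
      unfolding fixed[OF ext] using path_space_point[OF \<gamma>] by blast
    show "\<gamma> \<in> {\<gamma>. \<forall>t\<in>{0..1}. \<gamma> t \<in> ?S} \<inter>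
          {\<gamma>. \<exists>b\<in>topspace (fixed_space B \<beta> H). \<forall>t\<in>{0..1}. p (\<gamma> t) = b} \<longleftrightarrow>
        \<gamma> \<in> {\<gamma>. \<exists>b\<in>topspace B. \<forall>t\<in>{0..1}. p (\<gamma> t) = b} \<inter>
          {\<gamma> \<in> topspace (subtopology (path_space E) {\<gamma>. \<exists>b\<in>topspace B. \<forall>t\<in>{0..1}. p (\<gamma> t) = b}).
            \<forall>h\<in>H. path_action \<alpha> h \<gamma> = \<gamma>}"
      using \<gamma> S base[of \<gamma>] unfolding Int_iff mem_Collect_eq topspace_subtopology by argo
  qed
  finally show ?thesis by (rule sym)
qed

lemma fixed_space_fibre_product:
  "fixed_space (fibre_product E p) (diagonal_action \<alpha>) H = fibre_product (fixed_space E \<alpha> H) p"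
  unfolding fibre_product_def fixed_space_def subtopology_subtopology
    subtopology_Times[symmetric]
  by (rule subtopology_eqI) (auto simp: diagonal_action_def)

theorem proposition3p4:
  fixes G :: "('g, 'm) monoid_scheme" and T :: "'g topology"
    and E :: "'e topology" and \<alpha> :: "'g \<Rightarrow> 'e \<Rightarrow> 'e"
    and B :: "'b topology" and \<beta> :: "'g \<Rightarrow> 'b \<Rightarrow> 'b"
    and p :: "'e \<Rightarrow> 'b" and H K :: "'g set"
  assumes "topological_group G T"
    and "g_fibration G T E \<alpha> B \<beta> p"
    and "subgroup H G" and "subgroup K G"
    and "invariant_under K \<alpha> (topspace (fixed_space E \<alpha> H))"
    and "invariant_under K \<beta> (topspace (fixed_space B \<beta> H))"
    and "g_fibration (subgroup_of G K) (subtopology T K)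
           (fixed_space E \<alpha> H) \<alpha> (fixed_space B \<beta> H) \<beta> p"
  shows "param_TC (subgroup_of G K) (fixed_space E \<alpha> H) \<alpha> (fixed_space B \<beta> H) p
           \<le> param_TC G E \<alpha> B p"
proof -
  have H: "H \<subseteq> carrier G" and K: "K \<subseteq> carrier G"
    using assms(3,4) by (auto dest: subgroup.subset)
  have "p ` topspace (fixed_space E \<alpha> H) \<subseteq> topspace (fixed_space B \<beta> H)"
    using assms(7) by (auto simp: g_fibration_def g_map_def dest: continuous_map_image_subset_topspace)
  then have paths: "fixed_space (fibre_path_space E B p) (path_action \<alpha>) H =
      fibre_path_space (fixed_space E \<alpha> H) (fixed_space B \<beta> H) p"
    by (rule fixed_space_fibre_path_space)
  have p: "p (\<alpha> g x) = \<beta> g (p x)" if "g \<in> K" "x \<in> topspace (fixed_space E \<alpha> H)" for g x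
    using assms(7) that by (auto simp: g_fibration_def g_map_def equivariant_on_def)
  have "invariant_under K (diagonal_action \<alpha>) (topspace (fibre_product (fixed_space E \<alpha> H) p))"
    using assms(5) p by (auto simp: invariant_under_def diagonal_action_def fibre_product_def)
  then show ?thesis
    using g_secat_fixed_space_le[OF H K, of "diagonal_action \<alpha>" "fibre_product E p"
        "fibre_path_space E B p" "path_action \<alpha>" "\<lambda>\<gamma>. (\<gamma> 0, \<gamma> 1)"]
    by (simp add: param_TC_def paths fixed_space_fibre_product)
qed

end
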